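(* Let $\alpha\in[0,1]$, and consider discrete structured data (labeled graphs with weighted vertices) compared with the Fused Gromov-Wasserstein discrepancy $FGW$ with exponent $q\ge 1$ and trade-off parameter $\alpha$. (i) If $q=1$ and the structure matrices $\mathbf{C}_1,\mathbf{C}_2$ are distance matrices (such as shortest-path matrices), then $FGW$ defines a metric over the space of structured data quotiented by the measure preserving isometries that are also feature preserving. More precisely, $FGW$ satisfies the triangle inequality, and for two structured data $\mu=\sum_{i=1}^n h_i\delta_{(x_i,a_i)}$ and $\nu=\sum_{j=1}^m g_j\delta_{(y_j,b_j)}$ with structure matrices $\mathbf{C}_1,\mathbf{C}_2$, it vanishes if and only if $n=m$ and there exists a permutation $\sigma$ of $\{1,\dots,n\}$ such that $$\forall i,\ h_i=g_{\sigma(i)};\qquad \forall i,\ a_i=b_{\sigma(i)};\qquad \forall i,k,\ C_1(i,k)=C_2(\sigma(i),\sigma(k)).$$ (ii) If $q>1$, the triangle inequality is relaxed by a factor $2^{q-1}$, i.e. $FGW(\mu,\rho)\le 2^{q-1}\big(FGW(\mu,\nu)+FGW(\nu,\rho)\big)$, so that $FGW$ defines a semi-metric.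
   Context: A discrete structured datum is a probability measure $\mu=\sum_{i=1}^n h_i\delta_{(x_i,a_i)}$, where $a_i$ are features in a metric space $(\Omega_f,d)$ common to all graphs, $x_i$ are points of a structure space $(\Omega_s,C)$ specific to each graph, with $C:\Omega_s\times\Omega_s\to\mathbb{R}$ symmetric, the pairs $(x_i,a_i)$ are pairwise distinct, and $h=(h_i)_i$ is a probability vector with $h_i>0$ for all $i$ (full support). Its structure matrix is $\mathbf{C}=(C(x_i,x_k))_{i,k}$. For $\mu=\sum_{i=1}^n h_i\delta_{(x_i,a_i)}$ with structure matrix $\mathbf{C}_1$ and $\nu=\sum_{j=1}^m g_j\delta_{(y_j,b_j)}$ with structure matrix $\mathbf{C}_2$, let $\Pi(h,g)$ be the set of matrices $\pi\in\mathbb{R}_+^{n\times m}$ with row sums $h$ and column sums $g$. Then $$FGW(\mu,\nu)=\min_{\pi\in\Pi(h,g)}\ \sum_{i,j,k,l}\Big((1-\alpha)\,d(a_i,b_j)^q+\alpha\,|C_1(i,k)-C_2(j,l)|^q\Big)\pi_{i,j}\pi_{k,l}.$$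
   Formalization: "FGW = 0 implies a permutation", and the metric and semi-metric claims, are proved for 0<α<1 only, as they fail at α=0 (structure ignored) and α=1 (features ignored); the semi-metric claim in (ii) is for distance matrices, since for e.g. C=0 separation fails. *)

theory Defs
  imports "HOL-Analysis.Analysis"
begin

section \<open>Discrete structured data\<close>

text \<open>
  A discrete structured datum $\sum_{i=1}^n h_i \delta_{(x_i,a_i)}$ is given by its atoms, indexed by
  $1,\dots,n$ as in the formula. The structure space and its function are part of the datum, so every
  datum has its own; the feature space is a metric space common to all data. The values of the
  component functions outside \<open>{1..n}\<close>, and of \<open>sd_cost\<close> outside \<open>sd_space\<close>, are irrelevant.
\<close>

record ('s, 'f) structured_datum =
  sd_size :: nat
  sd_weight :: "nat \<Rightarrow> real"
  sd_point :: "nat \<Rightarrow> 's"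
  sd_feature :: "nat \<Rightarrow> 'f"
  sd_space :: "'s set"
  sd_cost :: "'s \<Rightarrow> 's \<Rightarrow> real"

definition sd_atom :: "('s, 'f) structured_datum \<Rightarrow> nat \<Rightarrow> 's \<times> 'f" where
  "sd_atom \<mu> i = (sd_point \<mu> i, sd_feature \<mu> i)"

definition structured_data :: "('s, 'f) structured_datum set" where
  "structured_data = {\<mu>.
     (\<forall>i\<in>{1..sd_size \<mu>}. sd_weight \<mu> i > 0) \<and>
     (\<Sum>i = 1..sd_size \<mu>. sd_weight \<mu> i) = 1 \<and>
     (\<forall>i\<in>{1..sd_size \<mu>}. sd_point \<mu> i \<in> sd_space \<mu>) \<and>
     inj_on (sd_atom \<mu>) {1..sd_size \<mu>} \<and>
     (\<forall>x\<in>sd_space \<mu>. \<forall>y\<in>sd_space \<mu>. sd_cost \<mu> x y = sd_cost \<mu> y x)}"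

definition structure_matrix :: "('s, 'f) structured_datum \<Rightarrow> nat \<Rightarrow> nat \<Rightarrow> real" where
  "structure_matrix \<mu> i k = sd_cost \<mu> (sd_point \<mu> i) (sd_point \<mu> k)"

text \<open>
  Data whose structure matrix is the matrix of pairwise distances of the points \<open>x\<^sub>1, \<dots>, x\<^sub>n\<close>.
  Two indices may carry the same structure point (with different features), so an entry vanishes
  exactly when the two points coincide, not only on the diagonal. Symmetry is part of
  \<open>structured_data\<close>.
\<close>

definition distance_data :: "('s, 'f) structured_datum set" where
  "distance_data = {\<mu> \<in> structured_data.
     (\<forall>i\<in>{1..sd_size \<mu>}. \<forall>k\<in>{1..sd_size \<mu>}.
        0 \<le> structure_matrix \<mu> i k \<and>
        (structure_matrix \<mu> i k = 0 \<longleftrightarrow> sd_point \<mu> i = sd_point \<mu> k)) \<and>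
     (\<forall>i\<in>{1..sd_size \<mu>}. \<forall>k\<in>{1..sd_size \<mu>}. \<forall>l\<in>{1..sd_size \<mu>}.
        structure_matrix \<mu> i l \<le> structure_matrix \<mu> i k + structure_matrix \<mu> k l)}"

section \<open>The Fused Gromov-Wasserstein discrepancy\<close>

definition couplings ::
    "('s, 'f) structured_datum \<Rightarrow> ('t, 'f) structured_datum \<Rightarrow> (nat \<Rightarrow> nat \<Rightarrow> real) set" where
  "couplings \<mu> \<nu> = {\<pi>.
     (\<forall>i\<in>{1..sd_size \<mu>}. \<forall>j\<in>{1..sd_size \<nu>}. 0 \<le> \<pi> i j) \<and>
     (\<forall>i\<in>{1..sd_size \<mu>}. (\<Sum>j = 1..sd_size \<nu>. \<pi> i j) = sd_weight \<mu> i) \<and>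
     (\<forall>j\<in>{1..sd_size \<nu>}. (\<Sum>i = 1..sd_size \<mu>. \<pi> i j) = sd_weight \<nu> j)}"

definition fgw_cost ::
    "real \<Rightarrow> real \<Rightarrow> ('s, 'f::metric_space) structured_datum \<Rightarrow> ('t, 'f) structured_datum \<Rightarrow>
      (nat \<Rightarrow> nat \<Rightarrow> real) \<Rightarrow> real" where
  "fgw_cost \<alpha> q \<mu> \<nu> \<pi> =
     (\<Sum>i = 1..sd_size \<mu>. \<Sum>j = 1..sd_size \<nu>. \<Sum>k = 1..sd_size \<mu>. \<Sum>l = 1..sd_size \<nu>.
        ((1 - \<alpha>) * dist (sd_feature \<mu> i) (sd_feature \<nu> j) powr q
          + \<alpha> * \<bar>structure_matrix \<mu> i k - structure_matrix \<nu> j l\<bar> powr q) * \<pi> i j * \<pi> k l)"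

text \<open>The infimum is a minimum, see lemma \<open>FGW_attained\<close> below.\<close>

definition FGW ::
    "real \<Rightarrow> real \<Rightarrow> ('s, 'f::metric_space) structured_datum \<Rightarrow> ('t, 'f) structured_datum \<Rightarrow> real" where
  "FGW \<alpha> q \<mu> \<nu> = (INF \<pi>\<in>couplings \<mu> \<nu>. fgw_cost \<alpha> q \<mu> \<nu> \<pi>)"

lemma product_coupling:
  assumes "\<mu> \<in> structured_data" "\<nu> \<in> structured_data"
  shows "(\<lambda>i j. sd_weight \<mu> i * sd_weight \<nu> j) \<in> couplings \<mu> \<nu>"
  using assms
  by (auto simp: couplings_def structured_data_def less_imp_le
      simp flip: sum_distrib_left sum_distrib_right)

lemma compact_fun_box:
  fixes A :: "'i \<Rightarrow> 'a::topological_space set"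
  assumes "\<And>i. compact (A i)"
  shows "compact {f. \<forall>i. f i \<in> A i}"
proof -
  have "compactin (product_topology (\<lambda>i. euclidean) UNIV) (PiE UNIV A)"
    using assms by (simp add: compactin_PiE)
  then have "compact (PiE UNIV A)"
    by (simp add: euclidean_product_topology)
  then show ?thesis
    by (simp add: PiE_UNIV_domain Pi_def)
qed

lemma FGW_attained:
  assumes \<mu>: "\<mu> \<in> structured_data" and \<nu>: "\<nu> \<in> structured_data"
  shows "\<exists>\<pi>\<in>couplings \<mu> \<nu>. fgw_cost \<alpha> q \<mu> \<nu> \<pi> = FGW \<alpha> q \<mu> \<nu> \<and>
           (\<forall>\<pi>'\<in>couplings \<mu> \<nu>. FGW \<alpha> q \<mu> \<nu> \<le> fgw_cost \<alpha> q \<mu> \<nu> \<pi>')"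
proof -
  define n m where "n = sd_size \<mu>" and "m = sd_size \<nu>"
  define c where "c = fgw_cost \<alpha> q \<mu> \<nu>"
  define B :: "(nat \<Rightarrow> nat \<Rightarrow> real) set" where "B = {\<pi>. \<forall>i. \<pi> i \<in> {r. \<forall>j. r j \<in> {0..1}}}"
  define K where "K = B \<inter> couplings \<mu> \<nu>"
  define trunc where
    "trunc \<pi> = (\<lambda>i j. if i \<in> {1..n} \<and> j \<in> {1..m} then \<pi> i j else 0)"
    for \<pi> :: "nat \<Rightarrow> nat \<Rightarrow> real"
  have cont_entry: "continuous_on S (\<lambda>\<pi>. \<pi> i j)" for i j and S :: "(nat \<Rightarrow> nat \<Rightarrow> real) set"
    by (rule continuous_on_product_then_coordinatewise[OF
          continuous_on_product_then_coordinatewise[OF continuous_on_id]])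
  have closed_ball: "closed {x. \<forall>i\<in>I. P i x}" if "\<And>i. i \<in> I \<Longrightarrow> closed {x. P i x}"
    for I :: "nat set" and P :: "nat \<Rightarrow> (nat \<Rightarrow> nat \<Rightarrow> real) \<Rightarrow> bool"
    using closed_INT[of I "\<lambda>i. {x. P i x}"] that by (simp add: Collect_ball_eq)
  have "compact B"
    unfolding B_def by (intro compact_fun_box) simp
  moreover have "closed (couplings \<mu> \<nu>)"
    unfolding couplings_def
    by (intro closed_Collect_conj closed_ball closed_Collect_le closed_Collect_eq
        continuous_on_sum continuous_on_const cont_entry)
  ultimately have "compact K"
    unfolding K_def by (rule compact_Int_closed)
  have cont: "continuous_on K c"
    unfolding c_def fgw_cost_def
    by (intro continuous_on_sum continuous_on_mult continuous_on_const cont_entry)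
  have trunc: "trunc \<pi> \<in> K \<and> c (trunc \<pi>) = c \<pi>" if \<pi>: "\<pi> \<in> couplings \<mu> \<nu>" for \<pi>
  proof -
    have nonneg: "0 \<le> \<pi> i j" if "i \<in> {1..n}" "j \<in> {1..m}" for i j
      using \<pi> that by (auto simp: couplings_def n_def m_def)
    have row: "(\<Sum>j = 1..m. \<pi> i j) = sd_weight \<mu> i" if "i \<in> {1..n}" for i
      using \<pi> that by (auto simp: couplings_def n_def m_def)
    have le1: "\<pi> i j \<le> 1" if "i \<in> {1..n}" "j \<in> {1..m}" for i j
    proof -
      have "\<pi> i j \<le> (\<Sum>j = 1..m. \<pi> i j)"
        using that nonneg by (intro member_le_sum) auto
      also have "\<dots> \<le> (\<Sum>i = 1..n. sd_weight \<mu> i)"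
        unfolding row[OF that(1)] using that \<mu>
        by (intro member_le_sum) (auto simp: structured_data_def n_def less_imp_le)
      finally show ?thesis
        using \<mu> by (simp add: structured_data_def n_def)
    qed
    have "trunc \<pi> \<in> B"
      using nonneg le1 by (auto simp: B_def trunc_def)
    moreover have "trunc \<pi> \<in> couplings \<mu> \<nu>"
      using \<pi> by (auto simp: couplings_def trunc_def n_def m_def)
    moreover have "c (trunc \<pi>) = c \<pi>"
      unfolding c_def fgw_cost_def
      by (intro sum.cong refl) (auto simp: trunc_def n_def m_def)
    ultimately show ?thesis
      by (simp add: K_def)
  qed
  have "K \<noteq> {}"
    using trunc product_coupling[OF \<mu> \<nu>] by blast
  then obtain \<pi> where \<pi>: "\<pi> \<in> K" "\<And>\<pi>'. \<pi>' \<in> K \<Longrightarrow> c \<pi> \<le> c \<pi>'"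
    using continuous_attains_inf[OF \<open>compact K\<close> _ cont] by blast
  have min: "c \<pi> \<le> c \<pi>'" if "\<pi>' \<in> couplings \<mu> \<nu>" for \<pi>'
    using trunc[OF that] \<pi>(2)[of "trunc \<pi>'"] by auto
  have mem: "\<pi> \<in> couplings \<mu> \<nu>"
    using \<pi>(1) by (simp add: K_def)
  have "FGW \<alpha> q \<mu> \<nu> = c \<pi>"
    unfolding FGW_def c_def[symmetric] by (rule cInf_eq_minimum) (use mem min in auto)
  then show ?thesis
    using mem min by (auto simp: c_def)
qed

section \<open>Identification of structured data\<close>

definition equal_up_to_permutation ::
    "('s, 'f) structured_datum \<Rightarrow> ('t, 'f) structured_datum \<Rightarrow> bool" where
  "equal_up_to_permutation \<mu> \<nu> \<longleftrightarrow>
     sd_size \<mu> = sd_size \<nu> \<and>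
     (\<exists>\<sigma>. \<sigma> permutes {1..sd_size \<mu>} \<and>
        (\<forall>i\<in>{1..sd_size \<mu>}. sd_weight \<mu> i = sd_weight \<nu> (\<sigma> i)) \<and>
        (\<forall>i\<in>{1..sd_size \<mu>}. sd_feature \<mu> i = sd_feature \<nu> (\<sigma> i)) \<and>
        (\<forall>i\<in>{1..sd_size \<mu>}. \<forall>k\<in>{1..sd_size \<mu>}.
           structure_matrix \<mu> i k = structure_matrix \<nu> (\<sigma> i) (\<sigma> k)))"

definition sd_support :: "('s, 'f) structured_datum \<Rightarrow> ('s \<times> 'f) set" where
  "sd_support \<mu> = sd_atom \<mu> ` {1..sd_size \<mu>}"

text \<open>
  The finitely supported measure $\sum_{i=1}^n h_i \delta_{(x_i,a_i)}$, as the push-forward under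
  $i \mapsto (x_i,a_i)$ of the weights on the index set, on the discrete $\sigma$-algebra.
\<close>

definition sd_measure :: "('s, 'f) structured_datum \<Rightarrow> ('s \<times> 'f) measure" where
  "sd_measure \<mu> =
     distr (point_measure {1..sd_size \<mu>} (\<lambda>i. ennreal (sd_weight \<mu> i))) (count_space UNIV) (sd_atom \<mu>)"

definition preserving_isometry ::
    "('s, 'f) structured_datum \<Rightarrow> ('t, 'f) structured_datum \<Rightarrow> ('s \<times> 'f \<Rightarrow> 't \<times> 'f) \<Rightarrow> bool" where
  "preserving_isometry \<mu> \<nu> \<phi> \<longleftrightarrow>
     bij_betw \<phi> (sd_support \<mu>) (sd_support \<nu>) \<and>
     distr (sd_measure \<mu>) (count_space UNIV) \<phi> = sd_measure \<nu> \<and>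
     (\<forall>p\<in>sd_support \<mu>. snd (\<phi> p) = snd p) \<and>
     (\<forall>p\<in>sd_support \<mu>. \<forall>p'\<in>sd_support \<mu>.
        sd_cost \<nu> (fst (\<phi> p)) (fst (\<phi> p')) = sd_cost \<mu> (fst p) (fst p'))"

definition sd_isomorphism :: "('s, 'f) structured_datum rel" where
  "sd_isomorphism = {(\<mu>, \<nu>). \<mu> \<in> distance_data \<and> \<nu> \<in> distance_data \<and>
     (\<exists>\<phi>. preserving_isometry \<mu> \<nu> \<phi>)}"

definition sd_quotient :: "('s, 'f) structured_datum set set" where
  "sd_quotient = distance_data // sd_isomorphism"

text \<open>
  The discrepancy induced on isomorphism classes: the common value of \<open>FGW\<close> on representatives.
  The value \<open>0\<close> outside the quotient is there because \<open>Metric_space\<close> asks for nonnegativity and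
  symmetry of a distance on the whole type.
\<close>

definition FGW_quotient ::
    "real \<Rightarrow> real \<Rightarrow> ('s, 'f::metric_space) structured_datum set \<Rightarrow> ('s, 'f) structured_datum set \<Rightarrow> real" where
  "FGW_quotient \<alpha> q X Y =
     (if X \<in> sd_quotient \<and> Y \<in> sd_quotient
      then the_elem {FGW \<alpha> q \<mu> \<nu> |\<mu> \<nu>. \<mu> \<in> X \<and> \<nu> \<in> Y} else 0)"

definition semimetric_on :: "'a set \<Rightarrow> ('a \<Rightarrow> 'a \<Rightarrow> real) \<Rightarrow> bool" where
  "semimetric_on M d \<longleftrightarrow>
     (\<forall>x\<in>M. \<forall>y\<in>M. 0 \<le> d x y \<and> d x y = d y x \<and> (d x y = 0 \<longleftrightarrow> x = y))"

section \<open>The endpoints of the trade-off parameter\<close>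

text \<open>
  For \<open>\<alpha> = 1\<close> the discrepancy ignores the features and for \<open>\<alpha> = 0\<close> it ignores the structure, so at
  the endpoints it vanishes between data that are not identified. The two lemmas exhibit such data.
\<close>

definition one_point :: "real \<Rightarrow> (nat, real) structured_datum" where
  "one_point a = \<lparr>sd_size = 1, sd_weight = (\<lambda>_. 1), sd_point = (\<lambda>i. i), sd_feature = (\<lambda>_. a),
     sd_space = UNIV, sd_cost = (\<lambda>x y. of_bool (x \<noteq> y))\<rparr>"

definition two_points :: "(nat, real) structured_datum" where
  "two_points = \<lparr>sd_size = 2, sd_weight = (\<lambda>_. 1/2), sd_point = (\<lambda>i. i), sd_feature = (\<lambda>_. 0),
     sd_space = UNIV, sd_cost = (\<lambda>x y. of_bool (x \<noteq> y))\<rparr>"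

lemmas endpoint_defs = one_point_def two_points_def distance_data_def structured_data_def
  structure_matrix_def sd_atom_def inj_on_def

lemma one_point_distance_data: "one_point a \<in> distance_data"
  by (auto simp: endpoint_defs)

lemma two_points_distance_data: "two_points \<in> distance_data"
  by (auto simp: endpoint_defs)

lemma FGW_eq_0I:
  assumes "\<mu> \<in> structured_data" "\<nu> \<in> structured_data" "\<And>\<pi>. fgw_cost \<alpha> q \<mu> \<nu> \<pi> = 0"
  shows "FGW \<alpha> q \<mu> \<nu> = 0"
  using FGW_attained[OF assms(1,2), of \<alpha> q] assms(3) by auto

lemma FGW_vanishes_endpoint_1:
  "FGW 1 q (one_point 0) (one_point 1) = 0"
  "\<not> equal_up_to_permutation (one_point 0) (one_point 1)"
proof -
  show "FGW 1 q (one_point 0) (one_point 1) = 0"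
    by (rule FGW_eq_0I)
      (use one_point_distance_data in \<open>auto simp: distance_data_def fgw_cost_def
        structure_matrix_def one_point_def\<close>)
  show "\<not> equal_up_to_permutation (one_point 0) (one_point 1)"
    by (auto simp: equal_up_to_permutation_def one_point_def)
qed

lemma FGW_vanishes_endpoint_0:
  "FGW 0 q (one_point 0) two_points = 0"
  "\<not> equal_up_to_permutation (one_point 0) two_points"
proof -
  show "FGW 0 q (one_point 0) two_points = 0"
    by (rule FGW_eq_0I)
      (use one_point_distance_data two_points_distance_data in
        \<open>auto simp: distance_data_def fgw_cost_def one_point_def two_points_def\<close>)
  show "\<not> equal_up_to_permutation (one_point 0) two_points"
    by (auto simp: equal_up_to_permutation_def one_point_def two_points_def)
qed

end

theory Submission
  imports Defs
begin

section \<open>Permutations and measure preserving isometries\<close>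

text \<open>Minimizing couplings exist (\<open>FGW_attained\<close>), so an upper bound for
  \<open>FGW\<close> only needs one good coupling, and a vanishing value is attained by a coupling
  of cost 0.

  Triangle inequality (\<open>FGW_triangle\<close>): by convexity of the power q, the integrand
  satisfies the triangle inequality up to the factor 2^(q-1), pointwise in pairs of index triples
  (\<open>fgw_loss_triangle\<close>). Two optimal couplings are glued over the middle datum into a
  law on triples. The cost is a quadratic form in the coupling, so all three costs become double
  sums over triples with the same product weights (\<open>fgw_cost_pushforward\<close>), and the
  pointwise bound can be summed. For q = 1 the factor is 1.

  Vanishing (\<open>equal_up_to_permutation_if_FGW_eq_0\<close>): for 0 < \<alpha> < 1, cost 0
  forces features and structure entries to agree on the support of the coupling. As atoms are
  distinct and distance 0 means equal points, the support is the graph of a bijection, and the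
  marginals then match the weights. At the endpoints one of the two terms disappears and this
  converse can fail.

  Quotient: since atoms are distinct, measure and feature preserving isometries of the supports
  amount to permutations of the indices (\<open>sd_isomorphism_iff\<close>). \<open>FGW\<close> is
  invariant under these (\<open>FGW_permute\<close>), hence descends to the classes.\<close>

lemma equal_up_to_permutation_refl: "equal_up_to_permutation \<mu> \<mu>"
  unfolding equal_up_to_permutation_def by (auto intro!: exI[of _ id] permutes_id)

lemma equal_up_to_permutation_sym:
  assumes "equal_up_to_permutation \<mu> \<nu>"
  shows "equal_up_to_permutation \<nu> \<mu>"
proof -
  define I where "I = {1..sd_size \<mu>}"
  obtain \<sigma> where size: "sd_size \<mu> = sd_size \<nu>" and perm: "\<sigma> permutes I"
    and w: "\<And>i. i \<in> I \<Longrightarrow> sd_weight \<mu> i = sd_weight \<nu> (\<sigma> i)"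
    and a: "\<And>i. i \<in> I \<Longrightarrow> sd_feature \<mu> i = sd_feature \<nu> (\<sigma> i)"
    and c: "\<And>i k. i \<in> I \<Longrightarrow> k \<in> I \<Longrightarrow>
      structure_matrix \<mu> i k = structure_matrix \<nu> (\<sigma> i) (\<sigma> k)"
    using assms by (auto simp: equal_up_to_permutation_def I_def)
  have inv: "inv \<sigma> i \<in> I" "\<sigma> (inv \<sigma> i) = i" if "i \<in> I" for i
    using that perm by (auto simp: permutes_inverses permutes_in_image[OF permutes_inv])
  show ?thesis
    unfolding equal_up_to_permutation_def size[symmetric] I_def[symmetric]
    by (intro conjI refl exI[of _ "inv \<sigma>"] permutes_inv perm) (simp_all add: inv w a c)
qed

lemma equal_up_to_permutation_trans:
  assumes "equal_up_to_permutation \<mu> \<nu>" "equal_up_to_permutation \<nu> \<rho>"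
  shows "equal_up_to_permutation \<mu> \<rho>"
proof -
  define I where "I = {1..sd_size \<mu>}"
  obtain \<sigma> where \<sigma>: "sd_size \<mu> = sd_size \<nu>" "\<sigma> permutes I"
    "\<And>i. i \<in> I \<Longrightarrow> sd_weight \<mu> i = sd_weight \<nu> (\<sigma> i)"
    "\<And>i. i \<in> I \<Longrightarrow> sd_feature \<mu> i = sd_feature \<nu> (\<sigma> i)"
    "\<And>i k. i \<in> I \<Longrightarrow> k \<in> I \<Longrightarrow> structure_matrix \<mu> i k = structure_matrix \<nu> (\<sigma> i) (\<sigma> k)"
    using assms(1) by (auto simp: equal_up_to_permutation_def I_def)
  obtain \<tau> where \<tau>: "sd_size \<nu> = sd_size \<rho>" "\<tau> permutes I"
    "\<And>i. i \<in> I \<Longrightarrow> sd_weight \<nu> i = sd_weight \<rho> (\<tau> i)"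
    "\<And>i. i \<in> I \<Longrightarrow> sd_feature \<nu> i = sd_feature \<rho> (\<tau> i)"
    "\<And>i k. i \<in> I \<Longrightarrow> k \<in> I \<Longrightarrow> structure_matrix \<nu> i k = structure_matrix \<rho> (\<tau> i) (\<tau> k)"
    using assms(2) by (auto simp: equal_up_to_permutation_def I_def \<sigma>(1))
  have in_I: "\<sigma> i \<in> I" if "i \<in> I" for i
    using that \<sigma>(2) by (simp add: permutes_in_image)
  show ?thesis
    unfolding equal_up_to_permutation_def I_def[symmetric]
    using \<sigma> \<tau> by (intro conjI exI[of _ "\<tau> \<circ> \<sigma>"] permutes_compose) (simp_all add: in_I)
qed

section \<open>Isometries of the supports and permutations of the indices\<close>

lemma emeasure_sd_measure:
  "emeasure (sd_measure \<mu>) A =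
    (\<Sum>i\<in>{i \<in> {1..sd_size \<mu>}. sd_atom \<mu> i \<in> A}. ennreal (sd_weight \<mu> i))"
proof -
  let ?P = "point_measure {1..sd_size \<mu>} (\<lambda>i. ennreal (sd_weight \<mu> i))"
  have "emeasure (sd_measure \<mu>) A = emeasure ?P (sd_atom \<mu> -` A \<inter> {1..sd_size \<mu>})"
    unfolding sd_measure_def by (subst emeasure_distr) (simp_all add: space_point_measure)
  also have "sd_atom \<mu> -` A \<inter> {1..sd_size \<mu>} = {i \<in> {1..sd_size \<mu>}. sd_atom \<mu> i \<in> A}"
    by auto
  also have "emeasure ?P \<dots> = (\<Sum>i\<in>\<dots>. ennreal (sd_weight \<mu> i))"
    by (rule emeasure_point_measure_finite) auto
  finally show ?thesis .
qed

lemma emeasure_distr_sd_measure: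
  "emeasure (distr (sd_measure \<mu>) (count_space UNIV) \<phi>) A =
    (\<Sum>i\<in>{i \<in> {1..sd_size \<mu>}. \<phi> (sd_atom \<mu> i) \<in> A}. ennreal (sd_weight \<mu> i))"
proof -
  have "\<phi> \<in> sd_measure \<mu> \<rightarrow>\<^sub>M count_space UNIV" "space (sd_measure \<mu>) = UNIV"
    by (simp_all add: sd_measure_def)
  then show ?thesis
    by (simp add: emeasure_distr emeasure_sd_measure)
qed

text \<open>Distinct atoms make \<open>sd_atom\<close> a bijection from indices onto the support, so
  an isometry transports to a bijection of indices. Equality of the measures on singletons gives the
  weights.\<close>

lemma preserving_isometry_imp_equal_up_to_permutation:
  assumes \<mu>: "\<mu> \<in> structured_data" and \<nu>: "\<nu> \<in> structured_data"
    and \<phi>: "preserving_isometry \<mu> \<nu> \<phi>"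
  shows "equal_up_to_permutation \<mu> \<nu>"
proof -
  define I J where "I = {1..sd_size \<mu>}" and "J = {1..sd_size \<nu>}"
  have bij_\<mu>: "bij_betw (sd_atom \<mu>) I (sd_support \<mu>)"
    and bij_\<nu>: "bij_betw (sd_atom \<nu>) J (sd_support \<nu>)"
    using \<mu> \<nu> by (auto simp: structured_data_def sd_support_def I_def J_def bij_betw_def)
  have bij_\<phi>: "bij_betw \<phi> (sd_support \<mu>) (sd_support \<nu>)"
    using \<phi> by (simp add: preserving_isometry_def)
  \<comment> \<open>The map \<open>\<phi>\<close> read in index coordinates.\<close>
  define \<tau> where "\<tau> = inv_into J (sd_atom \<nu>) \<circ> (\<phi> \<circ> sd_atom \<mu>)"
  have bij_\<tau>: "bij_betw \<tau> I J"
    unfolding \<tau>_def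
    by (intro bij_betw_trans[OF bij_betw_trans[OF bij_\<mu> bij_\<phi>] bij_betw_inv_into[OF bij_\<nu>]])
  then have size: "sd_size \<mu> = sd_size \<nu>"
    using bij_betw_same_card[OF bij_\<tau>] by (simp add: I_def J_def)
  then have IJ: "I = J"
    by (simp add: I_def J_def)
  have \<tau>_in: "\<tau> i \<in> J" if "i \<in> I" for i
    using bij_\<tau> that by (auto simp: bij_betw_def)
  have supp: "sd_atom \<mu> i \<in> sd_support \<mu>" if "i \<in> I" for i
    using that by (simp add: sd_support_def I_def)
  have atom: "sd_atom \<nu> (\<tau> i) = \<phi> (sd_atom \<mu> i)" if "i \<in> I" for i
    using that bij_betw_inv_into_right[OF bij_\<nu>, of "\<phi> (sd_atom \<mu> i)"] supp[OF that] bij_\<phi>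
    by (auto simp: \<tau>_def bij_betw_def)
  have weight: "sd_weight \<mu> i = sd_weight \<nu> (\<tau> i)" if "i \<in> I" for i
  proof -
    \<comment> \<open>By injectivity, this singleton is hit by exactly one index on each side, so
      both measures of it are single weights.\<close>
    let ?A = "{\<phi> (sd_atom \<mu> i)}"
    have inj: "inj_on (\<phi> \<circ> sd_atom \<mu>) I"
      using bij_betw_trans[OF bij_\<mu> bij_\<phi>] by (simp add: bij_betw_def)
    have "{i' \<in> I. \<phi> (sd_atom \<mu> i') \<in> ?A} = {i}"
      using inj_onD[OF inj] that by auto
    moreover have "{j \<in> J. sd_atom \<nu> j \<in> ?A} = {\<tau> i}"
      using inj_onD[OF bij_betw_imp_inj_on[OF bij_\<nu>]] \<tau>_in[OF that]
      by (auto simp: atom[OF that, symmetric])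
    moreover have "emeasure (distr (sd_measure \<mu>) (count_space UNIV) \<phi>) ?A
        = emeasure (sd_measure \<nu>) ?A"
      using \<phi> by (simp add: preserving_isometry_def)
    ultimately have "ennreal (sd_weight \<mu> i) = ennreal (sd_weight \<nu> (\<tau> i))"
      by (simp only: emeasure_distr_sd_measure emeasure_sd_measure
          I_def[symmetric] J_def[symmetric]) simp
    then show ?thesis
      using \<mu> \<nu> that \<tau>_in[OF that]
      by (auto simp: structured_data_def I_def J_def less_imp_le)
  qed
  have feature: "sd_feature \<mu> i = sd_feature \<nu> (\<tau> i)" if "i \<in> I" for i
    using \<phi> supp[OF that] atom[OF that, symmetric]
    by (auto simp: preserving_isometry_def sd_atom_def)
  have matrix: "structure_matrix \<mu> i k = structure_matrix \<nu> (\<tau> i) (\<tau> k)"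
    if "i \<in> I" "k \<in> I" for i k
  proof -
    have "sd_cost \<nu> (fst (\<phi> (sd_atom \<mu> i))) (fst (\<phi> (sd_atom \<mu> k)))
        = sd_cost \<mu> (fst (sd_atom \<mu> i)) (fst (sd_atom \<mu> k))"
      using \<phi> supp that by (simp add: preserving_isometry_def)
    then show ?thesis
      by (simp add: atom[symmetric] that) (simp add: sd_atom_def structure_matrix_def)
  qed
  \<comment> \<open>\<open>permutes\<close> asks for a map on all naturals that fixes everything
    outside \<open>I\<close>.\<close>
  define \<sigma> where "\<sigma> i = (if i \<in> I then \<tau> i else i)" for i
  have "bij_betw \<sigma> I I"
    using bij_\<tau> bij_betw_cong[of I \<sigma> \<tau> I] by (simp add: \<sigma>_def IJ)
  then have "\<sigma> permutes I"
    by (rule bij_imp_permutes) (simp add: \<sigma>_def)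
  then show ?thesis
    unfolding equal_up_to_permutation_def I_def[symmetric]
    using size weight feature matrix by (intro conjI exI[of _ \<sigma>]) (simp_all add: \<sigma>_def)
qed

text \<open>The converse conjugation: a permutation of indices, carried to the supports by the two
  atom bijections. Equality of the measures is reindexing a finite sum by
  \<open>\<sigma>\<close>.\<close>

lemma equal_up_to_permutation_imp_preserving_isometry:
  assumes \<mu>: "\<mu> \<in> structured_data" and \<nu>: "\<nu> \<in> structured_data"
    and eq: "equal_up_to_permutation \<mu> \<nu>"
  shows "\<exists>\<phi>. preserving_isometry \<mu> \<nu> \<phi>"
proof -
  define I where "I = {1..sd_size \<mu>}"
  obtain \<sigma> where size: "sd_size \<mu> = sd_size \<nu>" and perm: "\<sigma> permutes I"
    and w: "\<And>i. i \<in> I \<Longrightarrow> sd_weight \<mu> i = sd_weight \<nu> (\<sigma> i)"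
    and a: "\<And>i. i \<in> I \<Longrightarrow> sd_feature \<mu> i = sd_feature \<nu> (\<sigma> i)"
    and c: "\<And>i k. i \<in> I \<Longrightarrow> k \<in> I \<Longrightarrow>
      structure_matrix \<mu> i k = structure_matrix \<nu> (\<sigma> i) (\<sigma> k)"
    using eq by (auto simp: equal_up_to_permutation_def I_def)
  have bij_\<mu>: "bij_betw (sd_atom \<mu>) I (sd_support \<mu>)"
    and bij_\<nu>: "bij_betw (sd_atom \<nu>) I (sd_support \<nu>)"
    using \<mu> \<nu> by (auto simp: structured_data_def sd_support_def I_def size bij_betw_def)
  define \<phi> where "\<phi> = sd_atom \<nu> \<circ> (\<sigma> \<circ> inv_into I (sd_atom \<mu>))"
  have \<phi>: "\<phi> (sd_atom \<mu> i) = sd_atom \<nu> (\<sigma> i)" if "i \<in> I" for i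
    using that bij_\<mu> by (simp add: \<phi>_def bij_betw_inv_into_left)
  have bij: "bij_betw \<phi> (sd_support \<mu>) (sd_support \<nu>)"
    unfolding \<phi>_def
    by (intro bij_betw_trans[OF bij_betw_trans[OF bij_betw_inv_into[OF bij_\<mu>]
          permutes_imp_bij[OF perm]] bij_\<nu>])
  have measure: "distr (sd_measure \<mu>) (count_space UNIV) \<phi> = sd_measure \<nu>"
  proof (rule measure_eqI)
    show "sets (distr (sd_measure \<mu>) (count_space UNIV) \<phi>) = sets (sd_measure \<nu>)"
      by (simp add: sd_measure_def)
    fix A
    have "(\<Sum>i\<in>{i \<in> I. \<phi> (sd_atom \<mu> i) \<in> A}. ennreal (sd_weight \<mu> i))
        = (\<Sum>j\<in>{j \<in> I. sd_atom \<nu> j \<in> A}. ennreal (sd_weight \<nu> j))"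
      by (rule sum.reindex_bij_witness[of _ "inv \<sigma>" \<sigma>])
        (use perm in \<open>auto simp: permutes_inverses permutes_in_image
          permutes_in_image[OF permutes_inv] \<phi> w\<close>)
    then show "emeasure (distr (sd_measure \<mu>) (count_space UNIV) \<phi>) A = emeasure (sd_measure \<nu>) A"
      by (simp add: emeasure_distr_sd_measure emeasure_sd_measure I_def size)
  qed
  have supp: "sd_support \<mu> = sd_atom \<mu> ` I"
    by (simp add: sd_support_def I_def)
  have "preserving_isometry \<mu> \<nu> \<phi>"
    unfolding preserving_isometry_def
  proof (intro conjI bij measure)
    show "\<forall>p\<in>sd_support \<mu>. snd (\<phi> p) = snd p"
      by (simp add: supp \<phi>) (simp add: sd_atom_def a)
    show "\<forall>p\<in>sd_support \<mu>. \<forall>p'\<in>sd_support \<mu>.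
        sd_cost \<nu> (fst (\<phi> p)) (fst (\<phi> p')) = sd_cost \<mu> (fst p) (fst p')"
      by (simp add: supp \<phi>) (simp add: sd_atom_def c[unfolded structure_matrix_def])
  qed
  then show ?thesis by blast
qed

text \<open>Trades isometries for permutations, for which reflexivity, symmetry, transitivity and
  invariance of \<open>FGW\<close> are elementary.\<close>

lemma sd_isomorphism_iff:
  "(\<mu>, \<nu>) \<in> sd_isomorphism \<longleftrightarrow>
    \<mu> \<in> distance_data \<and> \<nu> \<in> distance_data \<and> equal_up_to_permutation \<mu> \<nu>"
proof -
  have "(\<exists>\<phi>. preserving_isometry \<mu> \<nu> \<phi>) \<longleftrightarrow> equal_up_to_permutation \<mu> \<nu>"
    if "\<mu> \<in> distance_data" "\<nu> \<in> distance_data"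
  proof -
    have "\<mu> \<in> structured_data" "\<nu> \<in> structured_data"
      using that by (simp_all add: distance_data_def)
    then show ?thesis
      using preserving_isometry_imp_equal_up_to_permutation
        equal_up_to_permutation_imp_preserving_isometry by metis
  qed
  then show ?thesis
    by (auto simp: sd_isomorphism_def)
qed

lemma equiv_sd_isomorphism: "equiv distance_data sd_isomorphism"
proof (rule equivI)
  show "sym sd_isomorphism"
    unfolding sym_def sd_isomorphism_iff by (blast dest: equal_up_to_permutation_sym)
  show "trans sd_isomorphism"
    unfolding trans_def sd_isomorphism_iff by (blast dest: equal_up_to_permutation_trans)
qed (auto simp: sd_isomorphism_iff refl_on_def equal_up_to_permutation_refl)

section \<open>Elementary properties of the discrepancy\<close>

lemma couplings_nonneg:
  "\<pi> \<in> couplings \<mu> \<nu> \<Longrightarrow> i \<in> {1..sd_size \<mu>} \<Longrightarrow> j \<in> {1..sd_size \<nu>} \<Longrightarrow> 0 \<le> \<pi> i j"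
  by (simp add: couplings_def)

lemma fgw_cost_nonneg:
  assumes "0 \<le> \<alpha>" "\<alpha> \<le> 1" "\<pi> \<in> couplings \<mu> \<nu>"
  shows "0 \<le> fgw_cost \<alpha> q \<mu> \<nu> \<pi>"
  unfolding fgw_cost_def
  using assms by (intro sum_nonneg mult_nonneg_nonneg add_nonneg_nonneg) (auto simp: couplings_def)

lemma FGW_le:
  assumes "\<mu> \<in> structured_data" "\<nu> \<in> structured_data" "\<pi> \<in> couplings \<mu> \<nu>"
  shows "FGW \<alpha> q \<mu> \<nu> \<le> fgw_cost \<alpha> q \<mu> \<nu> \<pi>"
  using FGW_attained assms by blast

lemma FGW_optimal:
  assumes "\<mu> \<in> structured_data" "\<nu> \<in> structured_data"
  obtains \<pi> where "\<pi> \<in> couplings \<mu> \<nu>" "fgw_cost \<alpha> q \<mu> \<nu> \<pi> = FGW \<alpha> q \<mu> \<nu>"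
  using FGW_attained assms by blast

lemma FGW_nonneg:
  assumes "0 \<le> \<alpha>" "\<alpha> \<le> 1" "\<mu> \<in> structured_data" "\<nu> \<in> structured_data"
  shows "0 \<le> FGW \<alpha> q \<mu> \<nu>"
  using FGW_optimal[OF assms(3,4)] fgw_cost_nonneg[OF assms(1,2)] by metis

section \<open>Symmetry and invariance under permutations\<close>

lemma FGW_swap_le:
  assumes \<mu>: "\<mu> \<in> structured_data" and \<nu>: "\<nu> \<in> structured_data"
  shows "FGW \<alpha> q \<nu> \<mu> \<le> FGW \<alpha> q \<mu> \<nu>"
proof -
  obtain \<pi> where \<pi>: "\<pi> \<in> couplings \<mu> \<nu>" "fgw_cost \<alpha> q \<mu> \<nu> \<pi> = FGW \<alpha> q \<mu> \<nu>"
    using FGW_optimal[OF \<mu> \<nu>] .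
  \<comment> \<open>The transposed coupling has the same cost. The sums over i, j and those over k,
    l are exchanged separately.\<close>
  have "(\<lambda>j i. \<pi> i j) \<in> couplings \<nu> \<mu>"
    using \<pi>(1) by (simp add: couplings_def)
  moreover have "fgw_cost \<alpha> q \<nu> \<mu> (\<lambda>j i. \<pi> i j) = fgw_cost \<alpha> q \<mu> \<nu> \<pi>"
    unfolding fgw_cost_def
    by (rule trans[OF sum.swap], (rule sum.cong[OF refl])+, rule trans[OF sum.swap],
        (rule sum.cong[OF refl])+) (simp add: dist_commute abs_minus_commute)
  ultimately show ?thesis
    using FGW_le[OF \<nu> \<mu>] \<pi>(2) by metis
qed

lemma FGW_commute:
  assumes "\<mu> \<in> structured_data" "\<nu> \<in> structured_data"
  shows "FGW \<alpha> q \<mu> \<nu> = FGW \<alpha> q \<nu> \<mu>"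
  by (intro antisym FGW_swap_le assms)

text \<open>Composing the rows of an optimal coupling for \<open>\<mu>'\<close> with
  \<open>\<sigma>\<close> gives a coupling for \<open>\<mu>\<close> of equal cost. Equality follows
  by symmetry of the relation.\<close>

lemma FGW_permute_left_le:
  assumes \<mu>: "\<mu> \<in> structured_data" and \<mu>': "\<mu>' \<in> structured_data" and \<nu>: "\<nu> \<in> structured_data"
    and eq: "equal_up_to_permutation \<mu> \<mu>'"
  shows "FGW \<alpha> q \<mu> \<nu> \<le> FGW \<alpha> q \<mu>' \<nu>"
proof -
  define I where "I = {1..sd_size \<mu>}"
  obtain \<sigma> where size: "sd_size \<mu>' = sd_size \<mu>" and perm: "\<sigma> permutes I"
    and w: "\<And>i. i \<in> I \<Longrightarrow> sd_weight \<mu>' (\<sigma> i) = sd_weight \<mu> i"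
    and a: "\<And>i. i \<in> I \<Longrightarrow> sd_feature \<mu>' (\<sigma> i) = sd_feature \<mu> i"
    and c: "\<And>i k. i \<in> I \<Longrightarrow> k \<in> I \<Longrightarrow>
      structure_matrix \<mu>' (\<sigma> i) (\<sigma> k) = structure_matrix \<mu> i k"
    using eq by (auto simp: equal_up_to_permutation_def I_def)
  obtain \<pi> where \<pi>: "\<pi> \<in> couplings \<mu>' \<nu>" "fgw_cost \<alpha> q \<mu>' \<nu> \<pi> = FGW \<alpha> q \<mu>' \<nu>"
    using FGW_optimal[OF \<mu>' \<nu>] .
  have in_I: "\<sigma> i \<in> I" if "i \<in> I" for i
    using that perm by (simp add: permutes_in_image)
  have permute: "(\<Sum>i\<in>I. f i) = (\<Sum>i\<in>I. f (\<sigma> i))" for f :: "nat \<Rightarrow> real"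
    using sum.permute[OF perm, of f] by simp
  have "(\<lambda>i j. \<pi> (\<sigma> i) j) \<in> couplings \<mu> \<nu>"
    using \<pi>(1) permute[of "\<lambda>i. \<pi> i j" for j]
    unfolding couplings_def size I_def[symmetric] by (simp add: in_I w)
  moreover have "fgw_cost \<alpha> q \<mu>' \<nu> \<pi> = fgw_cost \<alpha> q \<mu> \<nu> (\<lambda>i j. \<pi> (\<sigma> i) j)"
    unfolding fgw_cost_def size I_def[symmetric]
    by (rule trans[OF permute], rule sum.cong[OF refl], rule sum.cong[OF refl],
        rule trans[OF permute], (rule sum.cong[OF refl])+) (simp add: a c)
  ultimately show ?thesis
    using FGW_le[OF \<mu> \<nu>] \<pi>(2) by metis
qed

lemma FGW_permute_left:
  assumes "\<mu> \<in> structured_data" "\<mu>' \<in> structured_data" "\<nu> \<in> structured_data"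
    and "equal_up_to_permutation \<mu> \<mu>'"
  shows "FGW \<alpha> q \<mu> \<nu> = FGW \<alpha> q \<mu>' \<nu>"
  by (intro antisym FGW_permute_left_le equal_up_to_permutation_sym[OF assms(4)] assms)

lemma FGW_permute:
  assumes "\<mu> \<in> structured_data" "\<mu>' \<in> structured_data" "equal_up_to_permutation \<mu> \<mu>'"
    and "\<nu> \<in> structured_data" "\<nu>' \<in> structured_data" "equal_up_to_permutation \<nu> \<nu>'"
  shows "FGW \<alpha> q \<mu> \<nu> = FGW \<alpha> q \<mu>' \<nu>'"
proof -
  have "FGW \<alpha> q \<mu> \<nu> = FGW \<alpha> q \<mu>' \<nu>"
    using assms by (intro FGW_permute_left)
  also have "\<dots> = FGW \<alpha> q \<nu> \<mu>'"
    using assms by (intro FGW_commute)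
  also have "\<dots> = FGW \<alpha> q \<nu>' \<mu>'"
    using assms by (intro FGW_permute_left)
  also have "\<dots> = FGW \<alpha> q \<mu>' \<nu>'"
    using assms by (intro FGW_commute)
  finally show ?thesis .
qed

section \<open>Vanishing\<close>

lemma FGW_self:
  assumes "\<mu> \<in> structured_data" "0 \<le> \<alpha>" "\<alpha> \<le> 1"
  shows "FGW \<alpha> q \<mu> \<mu> = 0"
proof -
  \<comment> \<open>The identity transport: its only nonzero products have i = j and k = l, where
    the loss is 0.\<close>
  define \<pi> where "\<pi> i j = (if i = j then sd_weight \<mu> i else 0)" for i j
  have "\<pi> \<in> couplings \<mu> \<mu>"
    using assms(1) by (auto simp: couplings_def structured_data_def \<pi>_def less_imp_le)
  moreover have "fgw_cost \<alpha> q \<mu> \<mu> \<pi> = 0"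
    unfolding fgw_cost_def by (intro sum.neutral ballI) (simp add: \<pi>_def)
  ultimately show ?thesis
    using FGW_le[of \<mu> \<mu> \<pi> \<alpha> q] FGW_nonneg[of \<alpha> \<mu> \<mu> q] assms by simp
qed

lemma FGW_eq_0_if_equal_up_to_permutation:
  assumes "\<mu> \<in> structured_data" "\<nu> \<in> structured_data" "equal_up_to_permutation \<mu> \<nu>"
    and "0 \<le> \<alpha>" "\<alpha> \<le> 1"
  shows "FGW \<alpha> q \<mu> \<nu> = 0"
  using assms by (simp add: FGW_permute_left FGW_self)

text \<open>Serves for the rows and columns of a coupling supported on the graph of a
  bijection.\<close>

lemma sum_row_singleton:
  fixes f :: "'a \<Rightarrow> real"
  assumes "finite A" "x \<in> A" "\<And>y. y \<in> A \<Longrightarrow> f y \<noteq> 0 \<Longrightarrow> y = x"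
  shows "(\<Sum>y\<in>A. f y) = f x"
proof -
  have "\<forall>y\<in>A - {x}. f y = 0"
    using assms(3) by blast
  then have "sum f A = sum f {x}"
    using assms(1,2) by (intro sum.mono_neutral_right) simp_all
  then show ?thesis
    by simp
qed

text \<open>
  On the support of a coupling of cost \<open>0\<close> features agree and structure matrices agree. Two support
  points \<open>(i, j)\<close>, \<open>(i, j')\<close> therefore have \<open>b\<^sub>j = b\<^sub>j\<^sub>'\<close> and distance \<open>C\<^sub>2(j, j') = C\<^sub>1(i, i) = 0\<close>, so
  that \<open>j = j'\<close> as the atoms are distinct: the support is the graph of a permutation.
\<close>

lemma equal_up_to_permutation_if_FGW_eq_0:
  assumes \<mu>: "\<mu> \<in> distance_data" and \<nu>: "\<nu> \<in> distance_data"
    and \<alpha>: "0 < \<alpha>" "\<alpha> < 1" and zero: "FGW \<alpha> q \<mu> \<nu> = 0"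
  shows "equal_up_to_permutation \<mu> \<nu>"
proof -
  define I J where "I = {1..sd_size \<mu>}" and "J = {1..sd_size \<nu>}"
  have \<mu>': "\<mu> \<in> structured_data" and \<nu>': "\<nu> \<in> structured_data"
    using \<mu> \<nu> by (auto simp: distance_data_def)
  obtain \<pi> where \<pi>: "\<pi> \<in> couplings \<mu> \<nu>" "fgw_cost \<alpha> q \<mu> \<nu> \<pi> = 0"
    using FGW_optimal[OF \<mu>' \<nu>'] zero by metis
  define S where "S = {(i, j). i \<in> I \<and> j \<in> J \<and> \<pi> i j \<noteq> 0}"
  define t where "t i j k l =
    ((1 - \<alpha>) * dist (sd_feature \<mu> i) (sd_feature \<nu> j) powr q
      + \<alpha> * \<bar>structure_matrix \<mu> i k - structure_matrix \<nu> j l\<bar> powr q) * \<pi> i j * \<pi> k l" for i j k l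
  have t_nonneg: "0 \<le> t i j k l" if "i \<in> I" "j \<in> J" "k \<in> I" "l \<in> J" for i j k l
    using that \<alpha> couplings_nonneg[OF \<pi>(1)] by (simp add: t_def I_def J_def)
  have sum_t: "(\<Sum>i\<in>I. \<Sum>j\<in>J. \<Sum>k\<in>I. \<Sum>l\<in>J. t i j k l) = 0"
    using \<pi>(2) by (simp add: fgw_cost_def t_def I_def J_def)
  have fin: "finite I" "finite J"
    by (simp_all add: I_def J_def)
  \<comment> \<open>A vanishing sum of nonnegative terms has vanishing terms; this is applied once
    to each of the four nested sums.\<close>
  have t_zero: "t i j k l = 0" if "i \<in> I" "j \<in> J" "k \<in> I" "l \<in> J" for i j k l
  proof -
    have "(\<Sum>j\<in>J. \<Sum>k\<in>I. \<Sum>l\<in>J. t i j k l) = 0"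
      using sum_t that(1) fin by (subst (asm) sum_nonneg_eq_0_iff) (auto intro!: sum_nonneg t_nonneg)
    then have "(\<Sum>k\<in>I. \<Sum>l\<in>J. t i j k l) = 0"
      using that fin by (subst (asm) sum_nonneg_eq_0_iff) (auto intro!: sum_nonneg t_nonneg)
    then have "(\<Sum>l\<in>J. t i j k l) = 0"
      using that fin by (subst (asm) sum_nonneg_eq_0_iff) (auto intro!: sum_nonneg t_nonneg)
    then show ?thesis
      using that fin by (subst (asm) sum_nonneg_eq_0_iff) (auto intro!: t_nonneg)
  qed
  \<comment> \<open>On support points the coupling factors are nonzero, so the loss itself is 0.
    Both its summands are nonnegative with positive coefficients \<open>1 - \<alpha>\<close> and
    \<open>\<alpha>\<close>, so both vanish.\<close>
  have agree: "sd_feature \<mu> i = sd_feature \<nu> j \<and> structure_matrix \<mu> i k = structure_matrix \<nu> j l"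
    if ij: "(i, j) \<in> S" and kl: "(k, l) \<in> S" for i j k l
  proof -
    define x y where "x = dist (sd_feature \<mu> i) (sd_feature \<nu> j) powr q"
      and "y = \<bar>structure_matrix \<mu> i k - structure_matrix \<nu> j l\<bar> powr q"
    have "(1 - \<alpha>) * x + \<alpha> * y = 0"
      using ij kl t_zero[of i j k l] by (simp add: S_def t_def x_def y_def)
    moreover have "0 \<le> (1 - \<alpha>) * x" "0 \<le> \<alpha> * y"
      using \<alpha> by (simp_all add: x_def y_def)
    ultimately have "(1 - \<alpha>) * x = 0" "\<alpha> * y = 0"
      by linarith+
    then show ?thesis
      using \<alpha> by (simp add: x_def y_def)
  qed
  have row: "(\<Sum>j\<in>J. \<pi> i j) = sd_weight \<mu> i" if "i \<in> I" for i
    using \<pi>(1) that by (simp add: couplings_def I_def J_def)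
  have col: "(\<Sum>i\<in>I. \<pi> i j) = sd_weight \<nu> j" if "j \<in> J" for j
    using \<pi>(1) that by (simp add: couplings_def I_def J_def)
  have pos: "sd_weight \<mu> i > 0" if "i \<in> I" for i
    using \<mu>' that by (simp add: structured_data_def I_def)
  have pos': "sd_weight \<nu> j > 0" if "j \<in> J" for j
    using \<nu>' that by (simp add: structured_data_def J_def)
  \<comment> \<open>Kept generic in the datum, because it is applied to \<open>\<mu>\<close> and to
    \<open>\<nu>\<close>, whose structure types may differ.\<close>
  have atoms: "i = k"
    if "\<rho> \<in> distance_data" "i \<in> {1..sd_size \<rho>}" "k \<in> {1..sd_size \<rho>}"
      "sd_feature \<rho> i = sd_feature \<rho> k" "structure_matrix \<rho> i k = 0"
    for \<rho> :: "('x, 'b) structured_datum" and i k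
  proof -
    have "sd_point \<rho> i = sd_point \<rho> k"
      using that by (simp add: distance_data_def)
    then have "sd_atom \<rho> i = sd_atom \<rho> k"
      using that by (simp add: sd_atom_def)
    moreover have "inj_on (sd_atom \<rho>) {1..sd_size \<rho>}"
      using that by (simp add: distance_data_def structured_data_def)
    ultimately show ?thesis
      using that by (simp add: inj_on_eq_iff)
  qed
  have diag: "structure_matrix \<rho> i i = 0" if "\<rho> \<in> distance_data" "i \<in> {1..sd_size \<rho>}"
    for \<rho> :: "('x, 'b) structured_datum" and i
    using that by (simp add: distance_data_def)
  have right_unique: "j = j'" if "(i, j) \<in> S" "(i, j') \<in> S" for i j j'
  proof (rule atoms[OF \<nu>])
    show "j \<in> {1..sd_size \<nu>}" "j' \<in> {1..sd_size \<nu>}"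
      using that by (simp_all add: S_def J_def)
    have "i \<in> {1..sd_size \<mu>}"
      using that by (simp add: S_def I_def)
    then show "sd_feature \<nu> j = sd_feature \<nu> j'" "structure_matrix \<nu> j j' = 0"
      using agree[OF that] agree[OF that(2,2)] diag[OF \<mu>] by simp_all
  qed
  have left_unique: "i = i'" if "(i, j) \<in> S" "(i', j) \<in> S" for i i' j
  proof (rule atoms[OF \<mu>])
    show "i \<in> {1..sd_size \<mu>}" "i' \<in> {1..sd_size \<mu>}"
      using that by (simp_all add: S_def I_def)
    have "j \<in> {1..sd_size \<nu>}"
      using that by (simp add: S_def J_def)
    then show "sd_feature \<mu> i = sd_feature \<mu> i'" "structure_matrix \<mu> i i' = 0"
      using agree[OF that] agree[OF that(2,2)] diag[OF \<nu>] by simp_all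
  qed
  \<comment> \<open>Full support: an empty row of the support would give \<open>\<mu>\<close> a zero
    weight. The same argument for columns yields surjectivity.\<close>
  have "\<exists>j. (i, j) \<in> S" if "i \<in> I" for i
  proof (rule ccontr)
    assume "\<nexists>j. (i, j) \<in> S"
    then have "(\<Sum>j\<in>J. \<pi> i j) = 0"
      using that by (intro sum.neutral) (simp add: S_def)
    then show False
      using row[OF that] pos[OF that] by simp
  qed
  then obtain \<tau> where \<tau>: "(i, \<tau> i) \<in> S" if "i \<in> I" for i
    by metis
  have onto: "\<exists>i\<in>I. j = \<tau> i" if "j \<in> J" for j
  proof -
    obtain i where "(i, j) \<in> S"
    proof (rule ccontr)
      assume "\<not> thesis"
      then have "(\<Sum>i\<in>I. \<pi> i j) = 0"
        using that \<open>j \<in> J\<close> by (intro sum.neutral) (auto simp: S_def)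
      then show False
        using col[OF \<open>j \<in> J\<close>] pos'[OF \<open>j \<in> J\<close>] by simp
    qed
    moreover from this have "i \<in> I"
      by (simp add: S_def)
    ultimately show ?thesis
      using \<tau> right_unique by blast
  qed
  have \<tau>_in: "\<tau> i \<in> J" if "i \<in> I" for i
    using \<tau>[OF that] by (simp add: S_def)
  have bij: "bij_betw \<tau> I J"
  proof (rule bij_betwI')
    show "\<tau> i = \<tau> k \<longleftrightarrow> i = k" if "i \<in> I" "k \<in> I" for i k
      using that \<tau> left_unique by metis
  qed (fact \<tau>_in, fact onto)
  then have size: "sd_size \<mu> = sd_size \<nu>"
    using bij_betw_same_card[OF bij] by (simp add: I_def J_def)
  then have IJ: "I = J"
    by (simp add: I_def J_def)
  \<comment> \<open>Row i and column \<open>\<tau> i\<close> share their only nonzero entry, which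
    therefore equals both weights.\<close>
  have weight: "sd_weight \<mu> i = sd_weight \<nu> (\<tau> i)" if "i \<in> I" for i
  proof -
    have "j = \<tau> i" if "j \<in> J" "\<pi> i j \<noteq> 0" for j
      by (rule right_unique[OF _ \<tau>[OF \<open>i \<in> I\<close>]]) (use that \<open>i \<in> I\<close> in \<open>simp add: S_def\<close>)
    then have "(\<Sum>j\<in>J. \<pi> i j) = \<pi> i (\<tau> i)"
      by (rule sum_row_singleton[OF fin(2) \<tau>_in[OF that]])
    moreover have "k = i" if "k \<in> I" "\<pi> k (\<tau> i) \<noteq> 0" for k
      by (rule left_unique[OF _ \<tau>[OF \<open>i \<in> I\<close>]])
        (use that \<tau>_in[OF \<open>i \<in> I\<close>] in \<open>simp add: S_def\<close>)
    then have "(\<Sum>k\<in>I. \<pi> k (\<tau> i)) = \<pi> i (\<tau> i)"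
      by (rule sum_row_singleton[OF fin(1) that])
    ultimately show ?thesis
      by (simp only: row[OF that] col[OF \<tau>_in[OF that]])
  qed
  define \<sigma> where "\<sigma> i = (if i \<in> I then \<tau> i else i)" for i
  have "bij_betw \<sigma> I I"
    using bij bij_betw_cong[of I \<sigma> \<tau> I] by (simp add: \<sigma>_def IJ)
  then have "\<sigma> permutes I"
    by (rule bij_imp_permutes) (simp add: \<sigma>_def)
  then show ?thesis
    unfolding equal_up_to_permutation_def I_def[symmetric]
  proof (intro conjI exI[of _ \<sigma>] ballI size)
    show "sd_weight \<mu> i = sd_weight \<nu> (\<sigma> i)" "sd_feature \<mu> i = sd_feature \<nu> (\<sigma> i)"
      if "i \<in> I" for i
      using weight[OF that] agree[OF \<tau>[OF that] \<tau>[OF that]] that by (simp_all add: \<sigma>_def)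
    show "structure_matrix \<mu> i k = structure_matrix \<nu> (\<sigma> i) (\<sigma> k)" if "i \<in> I" "k \<in> I" for i k
      using agree[OF \<tau>[OF that(1)] \<tau>[OF that(2)]] that by (simp add: \<sigma>_def)
  qed
qed

section \<open>The relaxed triangle inequality\<close>

text \<open>Midpoint convexity of the power q bounds the q-th power of (a + b)/2 by the mean of the
  q-th powers; multiplying by 2^q gives the factor.\<close>

lemma powr_add_le:
  fixes a b q :: real
  assumes "0 \<le> a" "0 \<le> b" "1 \<le> q"
  shows "(a + b) powr q \<le> 2 powr (q - 1) * (a powr q + b powr q)"
proof (cases "a = 0 \<or> b = 0")
  \<comment> \<open>Convexity is applied only to positive a and b. If one of them is 0, the claim
    reduces to 1 being at most the factor.\<close>
  case True
  have "1 \<le> 2 powr (q - 1)"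
    using assms by (simp add: ge_one_powr_ge_zero)
  then have "x powr q \<le> 2 powr (q - 1) * x powr q" for x
    using mult_right_mono[of 1 "2 powr (q - 1)" "x powr q"] by simp
  then show ?thesis
    using True by auto
next
  case False
  then have pos: "0 < a" "0 < b"
    using assms by auto
  have "((1 - 1/2) *\<^sub>R a + (1/2) *\<^sub>R b) powr q \<le> (1 - 1/2) * a powr q + (1/2) * b powr q"
    by (rule convex_onD[OF powr_convex]) (use assms pos in auto)
  then have "((a + b) / 2) powr q \<le> (a powr q + b powr q) / 2"
    by (simp add: field_simps)
  then show ?thesis
    using pos by (simp add: powr_divide powr_diff field_simps)
qed

text \<open>The integrand as a kernel on pairs of index pairs, so that the cost is a quadratic form
  on the product index set.\<close>

definition fgw_loss ::
    "real \<Rightarrow> real \<Rightarrow> ('s, 'f::metric_space) structured_datum \<Rightarrow> ('t, 'f) structured_datum \<Rightarrow>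
      nat \<times> nat \<Rightarrow> nat \<times> nat \<Rightarrow> real" where
  "fgw_loss \<alpha> q \<mu> \<nu> = (\<lambda>(i, j) (k, l).
     (1 - \<alpha>) * dist (sd_feature \<mu> i) (sd_feature \<nu> j) powr q
       + \<alpha> * \<bar>structure_matrix \<mu> i k - structure_matrix \<nu> j l\<bar> powr q)"

text \<open>Both summands are q-th powers of distances, one in the feature space and one between
  reals. Each obeys the triangle inequality before the power is taken, and
  \<open>powr_add_le\<close> handles the power.\<close>

lemma fgw_loss_triangle:
  assumes "0 \<le> \<alpha>" "\<alpha> \<le> 1" "1 \<le> q"
  shows "fgw_loss \<alpha> q \<mu> \<rho> (i, l) (i', l') \<le>
    2 powr (q - 1) * (fgw_loss \<alpha> q \<mu> \<nu> (i, j) (i', j') + fgw_loss \<alpha> q \<nu> \<rho> (j, l) (j', l'))"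
proof -
  have bound: "c powr q \<le> 2 powr (q - 1) * (a powr q + b powr q)"
    if "c \<le> a + b" "0 \<le> a" "0 \<le> b" "0 \<le> c" for a b c :: real
    using powr_mono2[of q c "a + b"] powr_add_le[of a b q] that assms by linarith
  have "(1 - \<alpha>) * dist (sd_feature \<mu> i) (sd_feature \<rho> l) powr q \<le> (1 - \<alpha>) * (2 powr (q - 1) *
      (dist (sd_feature \<mu> i) (sd_feature \<nu> j) powr q + dist (sd_feature \<nu> j) (sd_feature \<rho> l) powr q))"
    using assms by (intro mult_left_mono bound dist_triangle) auto
  moreover have "\<alpha> * \<bar>structure_matrix \<mu> i i' - structure_matrix \<rho> l l'\<bar> powr q \<le>
      \<alpha> * (2 powr (q - 1) * (\<bar>structure_matrix \<mu> i i' - structure_matrix \<nu> j j'\<bar> powr q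
        + \<bar>structure_matrix \<nu> j j' - structure_matrix \<rho> l l'\<bar> powr q))"
    using assms by (intro mult_left_mono bound) auto
  ultimately show ?thesis
    unfolding fgw_loss_def by (simp add: algebra_simps)
qed

section \<open>Change of variables and gluing\<close>

lemma sum_times_pushforward:
  fixes r g :: "_ \<Rightarrow> real"
  assumes "finite T" "finite S" "f ` T \<subseteq> S" "\<And>s. s \<in> S \<Longrightarrow> w s = (\<Sum>t\<in>{t \<in> T. f t = s}. r t)"
  shows "(\<Sum>s\<in>S. g s * w s) = (\<Sum>t\<in>T. g (f t) * r t)"
proof -
  have "(\<Sum>s\<in>S. g s * w s) = (\<Sum>s\<in>S. \<Sum>t\<in>{t \<in> T. f t = s}. g (f t) * r t)"
    by (auto simp: assms(4) sum_distrib_left intro!: sum.cong)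
  also have "\<dots> = (\<Sum>t\<in>T. g (f t) * r t)"
    by (rule sum.group) (use assms in auto)
  finally show ?thesis .
qed

text \<open>If the coupling is the image of the weights \<open>r\<close> under \<open>f\<close>, the
  change of variables applies to each of the two integrations. This puts costs of couplings on
  different index sets over one common \<open>T\<close>.\<close>

lemma fgw_cost_pushforward:
  assumes T: "finite T" "f ` T \<subseteq> {1..sd_size \<mu>} \<times> {1..sd_size \<nu>}"
    and r: "\<And>i j. i \<in> {1..sd_size \<mu>} \<Longrightarrow> j \<in> {1..sd_size \<nu>} \<Longrightarrow>
      \<pi> i j = (\<Sum>t\<in>{t \<in> T. f t = (i, j)}. r t)"
  shows "fgw_cost \<alpha> q \<mu> \<nu> \<pi> = (\<Sum>t\<in>T. \<Sum>t'\<in>T. fgw_loss \<alpha> q \<mu> \<nu> (f t) (f t') * r t * r t')"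
proof -
  define S where "S = {1..sd_size \<mu>} \<times> {1..sd_size \<nu>}"
  define w where "w = (\<lambda>(i, j). \<pi> i j)"
  have push: "(\<Sum>s\<in>S. g s * w s) = (\<Sum>t\<in>T. g (f t) * r t)" for g
    by (rule sum_times_pushforward) (use T r in \<open>auto simp: S_def w_def\<close>)
  have "fgw_cost \<alpha> q \<mu> \<nu> \<pi> = (\<Sum>x\<in>S. \<Sum>y\<in>S. fgw_loss \<alpha> q \<mu> \<nu> x y * w x * w y)"
    by (simp add: fgw_cost_def S_def w_def fgw_loss_def sum.cartesian_product')
  also have "\<dots> = (\<Sum>x\<in>S. (\<Sum>y\<in>S. fgw_loss \<alpha> q \<mu> \<nu> x y * w y) * w x)"
    by (simp add: sum_distrib_left mult_ac)
  also have "\<dots> = (\<Sum>t\<in>T. (\<Sum>t'\<in>T. fgw_loss \<alpha> q \<mu> \<nu> (f t) (f t') * r t') * r t)"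
    by (simp only: push)
  also have "\<dots> = (\<Sum>t\<in>T. \<Sum>t'\<in>T. fgw_loss \<alpha> q \<mu> \<nu> (f t) (f t') * r t * r t')"
    by (simp add: sum_distrib_left mult_ac)
  finally show ?thesis .
qed

text \<open>Gluing: \<open>r\<close> below is a joint law of three vertices whose pair marginals are the two couplings.\<close>

lemma FGW_triangle:
  fixes \<mu> :: "('s, 'f::metric_space) structured_datum"
    and \<nu> :: "('t, 'f) structured_datum" and \<rho> :: "('u, 'f) structured_datum"
  assumes \<mu>: "\<mu> \<in> structured_data" and \<nu>: "\<nu> \<in> structured_data" and \<rho>: "\<rho> \<in> structured_data"
    and \<alpha>: "0 \<le> \<alpha>" "\<alpha> \<le> 1" and q: "1 \<le> q"
  shows "FGW \<alpha> q \<mu> \<rho> \<le> 2 powr (q - 1) * (FGW \<alpha> q \<mu> \<nu> + FGW \<alpha> q \<nu> \<rho>)"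
proof -
  define I J L where "I = {1..sd_size \<mu>}" and "J = {1..sd_size \<nu>}" and "L = {1..sd_size \<rho>}"
  have fin: "finite I" "finite J" "finite L"
    by (simp_all add: I_def J_def L_def)
  obtain \<pi>1 where \<pi>1: "\<pi>1 \<in> couplings \<mu> \<nu>" "fgw_cost \<alpha> q \<mu> \<nu> \<pi>1 = FGW \<alpha> q \<mu> \<nu>"
    using FGW_optimal[OF \<mu> \<nu>] .
  obtain \<pi>2 where \<pi>2: "\<pi>2 \<in> couplings \<nu> \<rho>" "fgw_cost \<alpha> q \<nu> \<rho> \<pi>2 = FGW \<alpha> q \<nu> \<rho>"
    using FGW_optimal[OF \<nu> \<rho>] .
  define g where "g = sd_weight \<nu>"
  have g: "g j > 0" if "j \<in> J" for j
    using \<nu> that by (simp add: structured_data_def J_def g_def)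
  \<comment> \<open>The first and third vertices are taken conditionally independent given the
    middle one. Division is harmless because the middle weights are positive.\<close>
  define s where "s i j l = \<pi>1 i j * \<pi>2 j l / g j" for i j l
  have s_nonneg: "0 \<le> s i j l" if "i \<in> I" "j \<in> J" "l \<in> L" for i j l
    using that couplings_nonneg[OF \<pi>1(1)] couplings_nonneg[OF \<pi>2(1)] g[of j]
    by (simp add: s_def I_def J_def L_def)
  have s_12: "(\<Sum>l\<in>L. s i j l) = \<pi>1 i j" if "j \<in> J" for i j
  proof -
    have "(\<Sum>l\<in>L. \<pi>2 j l) = g j"
      using \<pi>2(1) that by (simp add: couplings_def J_def L_def g_def)
    then show ?thesis
      using g[OF that] by (simp add: s_def flip: sum_divide_distrib sum_distrib_left)
  qed
  have s_23: "(\<Sum>i\<in>I. s i j l) = \<pi>2 j l" if "j \<in> J" for j l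
  proof -
    have "(\<Sum>i\<in>I. \<pi>1 i j) = g j"
      using \<pi>1(1) that by (simp add: couplings_def I_def J_def g_def)
    then show ?thesis
      using g[OF that] by (simp add: s_def flip: sum_divide_distrib sum_distrib_right)
  qed
  \<comment> \<open>The marginal on the outer vertices: the competitor for the left-hand
    side.\<close>
  define \<pi> where "\<pi> i l = (\<Sum>j\<in>J. s i j l)" for i l
  have \<pi>: "\<pi> \<in> couplings \<mu> \<rho>"
  proof -
    have "0 \<le> \<pi> i l" if "i \<in> I" "l \<in> L" for i l
      using that s_nonneg by (auto simp: \<pi>_def intro: sum_nonneg)
    moreover have "(\<Sum>l\<in>L. \<pi> i l) = sd_weight \<mu> i" if "i \<in> I" for i
      unfolding \<pi>_def
      by (subst sum.swap) (use \<pi>1(1) that in \<open>simp add: s_12 couplings_def I_def J_def\<close>)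
    moreover have "(\<Sum>i\<in>I. \<pi> i l) = sd_weight \<rho> l" if "l \<in> L" for l
      unfolding \<pi>_def
      by (subst sum.swap) (use \<pi>2(1) that in \<open>simp add: s_23 couplings_def J_def L_def\<close>)
    ultimately show ?thesis
      by (simp add: couplings_def I_def L_def)
  qed
  define T where "T = I \<times> J \<times> L"
  define r where "r = (\<lambda>(i, j, l). s i j l)"
  define p12 p23 p13 :: "nat \<times> nat \<times> nat \<Rightarrow> nat \<times> nat"
    where "p12 = (\<lambda>(i, j, l). (i, j))" and "p23 = (\<lambda>(i, j, l). (j, l))"
      and "p13 = (\<lambda>(i, j, l). (i, l))"
  have T: "finite T"
    using fin by (simp add: T_def)
  have cost_12: "FGW \<alpha> q \<mu> \<nu> = (\<Sum>t\<in>T. \<Sum>t'\<in>T. fgw_loss \<alpha> q \<mu> \<nu> (p12 t) (p12 t') * r t * r t')"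
    unfolding \<pi>1(2)[symmetric]
  proof (rule fgw_cost_pushforward[OF T])
    fix i j assume ij: "i \<in> {1..sd_size \<mu>}" "j \<in> {1..sd_size \<nu>}"
    then have "(\<Sum>t\<in>{t \<in> T. p12 t = (i, j)}. r t) = (\<Sum>l\<in>L. s i j l)"
      by (intro sum.reindex_bij_witness[of _ "\<lambda>l. (i, j, l)" "\<lambda>(i, j, l). l"])
        (auto simp: T_def r_def p12_def I_def J_def)
    then show "\<pi>1 i j = (\<Sum>t\<in>{t \<in> T. p12 t = (i, j)}. r t)"
      using ij by (simp add: s_12 J_def)
  qed (auto simp: T_def p12_def I_def J_def)
  have cost_23: "FGW \<alpha> q \<nu> \<rho> = (\<Sum>t\<in>T. \<Sum>t'\<in>T. fgw_loss \<alpha> q \<nu> \<rho> (p23 t) (p23 t') * r t * r t')"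
    unfolding \<pi>2(2)[symmetric]
  proof (rule fgw_cost_pushforward[OF T])
    fix j l assume jl: "j \<in> {1..sd_size \<nu>}" "l \<in> {1..sd_size \<rho>}"
    then have "(\<Sum>t\<in>{t \<in> T. p23 t = (j, l)}. r t) = (\<Sum>i\<in>I. s i j l)"
      by (intro sum.reindex_bij_witness[of _ "\<lambda>i. (i, j, l)" "\<lambda>(i, j, l). i"])
        (auto simp: T_def r_def p23_def J_def L_def)
    then show "\<pi>2 j l = (\<Sum>t\<in>{t \<in> T. p23 t = (j, l)}. r t)"
      using jl by (simp add: s_23 J_def)
  qed (auto simp: T_def p23_def J_def L_def)
  have cost_13: "fgw_cost \<alpha> q \<mu> \<rho> \<pi>
      = (\<Sum>t\<in>T. \<Sum>t'\<in>T. fgw_loss \<alpha> q \<mu> \<rho> (p13 t) (p13 t') * r t * r t')"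
  proof (rule fgw_cost_pushforward[OF T])
    fix i l assume "i \<in> {1..sd_size \<mu>}" "l \<in> {1..sd_size \<rho>}"
    then show "\<pi> i l = (\<Sum>t\<in>{t \<in> T. p13 t = (i, l)}. r t)"
      unfolding \<pi>_def
      by (intro sum.reindex_bij_witness[of _ "\<lambda>(i, j, l). j" "\<lambda>j. (i, j, l)"])
        (auto simp: T_def r_def p13_def I_def L_def)
  qed (auto simp: T_def p13_def I_def L_def)
  have r_nonneg: "0 \<le> r t" if "t \<in> T" for t
    using that s_nonneg by (auto simp: T_def r_def)
  have "FGW \<alpha> q \<mu> \<rho> \<le> fgw_cost \<alpha> q \<mu> \<rho> \<pi>"
    using FGW_le[OF \<mu> \<rho> \<pi>] .
  \<comment> \<open>All three costs now carry the same nonnegative weights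
    \<open>r t * r t'\<close>, so the pointwise inequality is summed term by term.\<close>
  also have "\<dots> \<le> (\<Sum>t\<in>T. \<Sum>t'\<in>T. (2 powr (q - 1) *
      (fgw_loss \<alpha> q \<mu> \<nu> (p12 t) (p12 t') + fgw_loss \<alpha> q \<nu> \<rho> (p23 t) (p23 t'))) * r t * r t')"
    unfolding cost_13 using \<alpha> q
    by (intro sum_mono mult_right_mono r_nonneg)
      (auto simp: p12_def p13_def p23_def split_def intro: fgw_loss_triangle)
  also have "\<dots> = 2 powr (q - 1) * (FGW \<alpha> q \<mu> \<nu> + FGW \<alpha> q \<nu> \<rho>)"
    unfolding cost_12 cost_23
    by (simp add: sum_distrib_left distrib_left distrib_right sum.distrib mult.assoc)
  finally show ?thesis .
qed

section \<open>The quotient\<close>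

text \<open>By \<open>FGW_permute\<close> the set of values on representatives is a singleton, so
  \<open>the_elem\<close> returns the expected number.\<close>

lemma FGW_quotient_class:
  fixes \<mu> \<nu> :: "('s, 'f::metric_space) structured_datum"
  assumes \<mu>: "\<mu> \<in> distance_data" and \<nu>: "\<nu> \<in> distance_data"
  shows "FGW_quotient \<alpha> q (sd_isomorphism `` {\<mu>}) (sd_isomorphism `` {\<nu>}) = FGW \<alpha> q \<mu> \<nu>"
proof -
  have "{FGW \<alpha> q \<mu>' \<nu>' |\<mu>' \<nu>'. \<mu>' \<in> sd_isomorphism `` {\<mu>} \<and> \<nu>' \<in> sd_isomorphism `` {\<nu>}}
      = {FGW \<alpha> q \<mu> \<nu>}" (is "?A = _")
  proof (intro equalityI subsetI)
    fix x assume "x \<in> ?A"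
    then obtain \<mu>' \<nu>' where "x = FGW \<alpha> q \<mu>' \<nu>'" "(\<mu>, \<mu>') \<in> sd_isomorphism"
      "(\<nu>, \<nu>') \<in> sd_isomorphism"
      by auto
    then show "x \<in> {FGW \<alpha> q \<mu> \<nu>}"
      using FGW_permute[of \<mu> \<mu>' \<nu> \<nu>' \<alpha> q] by (simp add: sd_isomorphism_iff distance_data_def)
  next
    fix x assume "x \<in> {FGW \<alpha> q \<mu> \<nu>}"
    then show "x \<in> ?A"
      using equiv_class_self[OF equiv_sd_isomorphism \<mu>]
        equiv_class_self[OF equiv_sd_isomorphism \<nu>] by blast
  qed
  then show ?thesis
    using \<mu> \<nu> by (simp add: FGW_quotient_def sd_quotient_def quotientI)
qed

lemma sd_quotientE:
  assumes "X \<in> sd_quotient"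
  obtains \<mu> where "\<mu> \<in> distance_data" "\<mu> \<in> structured_data" "X = sd_isomorphism `` {\<mu>}"
  using assms unfolding sd_quotient_def by (auto elim!: quotientE simp: distance_data_def)

text \<open>\<open>Metric_space\<close> demands this on the whole type; unless both arguments are
  classes, the value is the default 0.\<close>

lemma FGW_quotient_nonneg:
  assumes "0 \<le> \<alpha>" "\<alpha> \<le> 1"
  shows "0 \<le> FGW_quotient \<alpha> q X Y"
proof (cases "X \<in> sd_quotient \<and> Y \<in> sd_quotient")
  case True
  then show ?thesis
    using assms by (auto elim!: sd_quotientE simp: FGW_quotient_class FGW_nonneg)
qed (auto simp: FGW_quotient_def)

lemma FGW_quotient_commute: "FGW_quotient \<alpha> q X Y = FGW_quotient \<alpha> q Y X"
proof (cases "X \<in> sd_quotient \<and> Y \<in> sd_quotient")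
  case True
  then obtain \<mu> \<nu> where "\<mu> \<in> distance_data" "\<mu> \<in> structured_data" "X = sd_isomorphism `` {\<mu>}"
    and "\<nu> \<in> distance_data" "\<nu> \<in> structured_data" "Y = sd_isomorphism `` {\<nu>}"
    by (meson sd_quotientE)
  then show ?thesis
    using FGW_commute[of \<mu> \<nu> \<alpha> q] by (simp add: FGW_quotient_class)
qed (auto simp: FGW_quotient_def)

text \<open>Classes coincide exactly when their representatives are related, so this is the
  vanishing criterion for \<open>FGW\<close> read through \<open>sd_isomorphism_iff\<close>.\<close>

lemma FGW_quotient_eq_0_iff:
  assumes "0 < \<alpha>" "\<alpha> < 1" and X: "X \<in> sd_quotient" and Y: "Y \<in> sd_quotient"
  shows "FGW_quotient \<alpha> q X Y = 0 \<longleftrightarrow> X = Y"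
proof -
  obtain \<mu> where \<mu>: "\<mu> \<in> distance_data" "\<mu> \<in> structured_data" "X = sd_isomorphism `` {\<mu>}"
    using X by (rule sd_quotientE)
  obtain \<nu> where \<nu>: "\<nu> \<in> distance_data" "\<nu> \<in> structured_data" "Y = sd_isomorphism `` {\<nu>}"
    using Y by (rule sd_quotientE)
  have "FGW \<alpha> q \<mu> \<nu> = 0 \<longleftrightarrow> equal_up_to_permutation \<mu> \<nu>"
    using assms(1,2) \<mu> \<nu> equal_up_to_permutation_if_FGW_eq_0
    by (auto intro!: FGW_eq_0_if_equal_up_to_permutation)
  then show ?thesis
    using \<mu> \<nu> eq_equiv_class_iff[OF equiv_sd_isomorphism \<mu>(1) \<nu>(1)]
    by (simp add: FGW_quotient_class sd_isomorphism_iff)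
qed

text \<open>At exponent 1 the factor in \<open>FGW_triangle\<close> is \<open>2 powr 0 = 1\<close>,
  so representatives satisfy the exact triangle inequality.\<close>

lemma Metric_space_FGW_quotient:
  assumes "0 < \<alpha>" "\<alpha> < 1"
  shows "Metric_space sd_quotient (FGW_quotient \<alpha> 1)"
proof
  show "FGW_quotient \<alpha> 1 X Z \<le> FGW_quotient \<alpha> 1 X Y + FGW_quotient \<alpha> 1 Y Z"
    if "X \<in> sd_quotient" "Y \<in> sd_quotient" "Z \<in> sd_quotient" for X Y Z
  proof -
    obtain \<mu> where \<mu>: "\<mu> \<in> distance_data" "\<mu> \<in> structured_data" "X = sd_isomorphism `` {\<mu>}"
      using \<open>X \<in> sd_quotient\<close> by (rule sd_quotientE)
    obtain \<nu> where \<nu>: "\<nu> \<in> distance_data" "\<nu> \<in> structured_data" "Y = sd_isomorphism `` {\<nu>}"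
      using \<open>Y \<in> sd_quotient\<close> by (rule sd_quotientE)
    obtain \<rho> where \<rho>: "\<rho> \<in> distance_data" "\<rho> \<in> structured_data" "Z = sd_isomorphism `` {\<rho>}"
      using \<open>Z \<in> sd_quotient\<close> by (rule sd_quotientE)
    show ?thesis
      using \<mu> \<nu> \<rho> FGW_triangle[of \<mu> \<nu> \<rho> \<alpha> 1] assms by (simp add: FGW_quotient_class)
  qed
qed (use assms in \<open>simp_all add: FGW_quotient_nonneg FGW_quotient_eq_0_iff
      FGW_quotient_commute\<close>)

lemma semimetric_on_FGW_quotient:
  assumes "0 < \<alpha>" "\<alpha> < 1"
  shows "semimetric_on sd_quotient (FGW_quotient \<alpha> q)"
  unfolding semimetric_on_def
  using assms by (simp add: FGW_quotient_nonneg FGW_quotient_eq_0_iff FGW_quotient_commute)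

theorem theorem3p3p1:
  fixes \<alpha> q :: real
  assumes alpha: "0 \<le> \<alpha>" "\<alpha> \<le> 1" and q: "1 \<le> q"
  shows
    "(\<comment> \<open>nonnegativity and symmetry\<close>
      \<forall>\<mu>\<in>(structured_data :: ('s, 'f::metric_space) structured_datum set).
        \<forall>\<nu>\<in>(structured_data :: ('t, 'f) structured_datum set).
          0 \<le> FGW \<alpha> q \<mu> \<nu> \<and> FGW \<alpha> q \<mu> \<nu> = FGW \<alpha> q \<nu> \<mu>) \<and>
     (\<comment> \<open>the quotient, and the induced function on it, are well defined\<close>
      equiv distance_data (sd_isomorphism :: ('s, 'f) structured_datum rel) \<and>
      (\<forall>\<mu>\<in>(distance_data :: ('s, 'f) structured_datum set). \<forall>\<nu>\<in>distance_data.
          FGW_quotient \<alpha> q (sd_isomorphism `` {\<mu>}) (sd_isomorphism `` {\<nu>}) = FGW \<alpha> q \<mu> \<nu>)) \<and>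
     (\<comment> \<open>(i)\<close>
      q = 1 \<longrightarrow>
        (\<forall>\<mu>\<in>(distance_data :: ('s, 'f) structured_datum set).
          \<forall>\<nu>\<in>(distance_data :: ('t, 'f) structured_datum set).
            \<forall>\<rho>\<in>(distance_data :: ('u, 'f) structured_datum set).
              FGW \<alpha> q \<mu> \<rho> \<le> FGW \<alpha> q \<mu> \<nu> + FGW \<alpha> q \<nu> \<rho>) \<and>
        (\<forall>\<mu>\<in>(distance_data :: ('s, 'f) structured_datum set).
          \<forall>\<nu>\<in>(distance_data :: ('t, 'f) structured_datum set).
            (equal_up_to_permutation \<mu> \<nu> \<longrightarrow> FGW \<alpha> q \<mu> \<nu> = 0) \<and>
            (0 < \<alpha> \<and> \<alpha> < 1 \<longrightarrow> (FGW \<alpha> q \<mu> \<nu> = 0 \<longleftrightarrow> equal_up_to_permutation \<mu> \<nu>))) \<and>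
        (0 < \<alpha> \<and> \<alpha> < 1 \<longrightarrow>
          Metric_space (sd_quotient :: ('s, 'f) structured_datum set set) (FGW_quotient \<alpha> q))) \<and>
     (\<comment> \<open>(ii)\<close>
      1 < q \<longrightarrow>
        (\<forall>\<mu>\<in>(structured_data :: ('s, 'f) structured_datum set).
          \<forall>\<nu>\<in>(structured_data :: ('t, 'f) structured_datum set).
            \<forall>\<rho>\<in>(structured_data :: ('u, 'f) structured_datum set).
              FGW \<alpha> q \<mu> \<rho> \<le> 2 powr (q - 1) * (FGW \<alpha> q \<mu> \<nu> + FGW \<alpha> q \<nu> \<rho>)) \<and>
        (0 < \<alpha> \<and> \<alpha> < 1 \<longrightarrow>
          semimetric_on (sd_quotient :: ('s, 'f) structured_datum set set) (FGW_quotient \<alpha> q)))"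
proof -
  have sub: "\<mu> \<in> structured_data" if "\<mu> \<in> distance_data" for \<mu> :: "('x, 'f) structured_datum"
    using that by (simp add: distance_data_def)
  have triangle: "FGW \<alpha> q \<mu> \<rho> \<le> FGW \<alpha> q \<mu> \<nu> + FGW \<alpha> q \<nu> \<rho>"
    if "q = 1" "\<mu> \<in> distance_data" "\<nu> \<in> distance_data" "\<rho> \<in> distance_data"
    for \<mu> :: "('s, 'f) structured_datum" and \<nu> :: "('t, 'f) structured_datum"
      and \<rho> :: "('u, 'f) structured_datum"
    using FGW_triangle[of \<mu> \<nu> \<rho> \<alpha> q] that alpha by (simp add: distance_data_def)
  show ?thesis
  proof (intro conjI impI ballI)
    show "0 \<le> FGW \<alpha> q \<mu> \<nu>" "FGW \<alpha> q \<mu> \<nu> = FGW \<alpha> q \<nu> \<mu>"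
      if "\<mu> \<in> structured_data" "\<nu> \<in> structured_data"
      for \<mu> :: "('s, 'f) structured_datum" and \<nu> :: "('t, 'f) structured_datum"
      using that alpha by (simp_all add: FGW_nonneg FGW_commute[of \<mu> \<nu>])
    show "FGW \<alpha> q \<mu> \<nu> = 0" if "\<mu> \<in> distance_data" "\<nu> \<in> distance_data" "equal_up_to_permutation \<mu> \<nu>"
      for \<mu> :: "('s, 'f) structured_datum" and \<nu> :: "('t, 'f) structured_datum"
      using that alpha by (simp add: FGW_eq_0_if_equal_up_to_permutation sub)
    then show "FGW \<alpha> q \<mu> \<nu> = 0 \<longleftrightarrow> equal_up_to_permutation \<mu> \<nu>"
      if "\<mu> \<in> distance_data" "\<nu> \<in> distance_data" "0 < \<alpha> \<and> \<alpha> < 1"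
      for \<mu> :: "('s, 'f) structured_datum" and \<nu> :: "('t, 'f) structured_datum"
      using that equal_up_to_permutation_if_FGW_eq_0 by blast
  qed (use alpha q triangle in \<open>simp_all add: FGW_quotient_class equiv_sd_isomorphism FGW_triangle
      Metric_space_FGW_quotient semimetric_on_FGW_quotient\<close>)
qed

end
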